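(* Every graph in $\varepsilon_{12}$ is planar.
   Context: All graphs are finite, simple and connected. An Euler graph is a connected graph all of whose nodes have even degree. $\varepsilon_{12}$ is the class of Euler graphs in which every cycle has length $\equiv 1$ or $\equiv 2\pmod 4$ and which contain at least one cycle of each of these two kinds. *)

theory Defs
  imports "HOL-Analysis.Analysis" "Graph_Theory.Graph_Theory"
begin

text \<open>Finite simple graphs are the symmetric loop-free digraphs \<^const>\<open>pair_graph\<close>: an
  undirected edge \<open>uv\<close> is the pair of arcs \<open>(u,v)\<close>, \<open>(v,u)\<close>, so the degree of a vertex is its
  \<^const>\<open>out_degree\<close>.\<close>

definition Euler_graph :: "'a pair_pre_digraph \<Rightarrow> bool" where
  "Euler_graph G \<longleftrightarrow>
     pair_graph G \<and> Digraph_Component.connected (with_proj G) \<and>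
     (\<forall>v \<in> pverts G. even (out_degree (with_proj G) v))"

text \<open>The bound on the length excludes the directed cycles \<open>[(u,v), (v,u)]\<close>, which traverse one
  undirected edge back and forth.\<close>

definition undirected_cycle :: "'a pair_pre_digraph \<Rightarrow> ('a \<times> 'a) list \<Rightarrow> bool" where
  "undirected_cycle G p \<longleftrightarrow> pre_digraph.cycle (with_proj G) p \<and> 3 \<le> length p"

definition eps12 :: "'a pair_pre_digraph set" where
  "eps12 = {G. Euler_graph G \<and>
     (\<forall>p. undirected_cycle G p \<longrightarrow> length p mod 4 = 1 \<or> length p mod 4 = 2) \<and>
     (\<exists>p. undirected_cycle G p \<and> length p mod 4 = 1) \<and>
     (\<exists>p. undirected_cycle G p \<and> length p mod 4 = 2)}"

text \<open>The curves are indexed by the undirected edges \<open>{u,v}\<close>, so that the two arcs of an edge share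
  one (unoriented) curve.\<close>

definition plane_embedding ::
  "'a pair_pre_digraph \<Rightarrow> ('a \<Rightarrow> real^2) \<Rightarrow> ('a set \<Rightarrow> real \<Rightarrow> real^2) \<Rightarrow> bool" where
  "plane_embedding G \<phi> \<gamma> \<longleftrightarrow>
     inj_on \<phi> (pverts G) \<and>
     (\<forall>(u,v) \<in> parcs G.
        arc (\<gamma> {u,v}) \<and>
        {pathstart (\<gamma> {u,v}), pathfinish (\<gamma> {u,v})} = {\<phi> u, \<phi> v} \<and>
        path_image (\<gamma> {u,v}) \<inter> \<phi> ` pverts G = {\<phi> u, \<phi> v}) \<and>
     (\<forall>(u,v) \<in> parcs G. \<forall>(x,y) \<in> parcs G. {u,v} \<noteq> {x,y} \<longrightarrow>
        path_image (\<gamma> {u,v}) \<inter> path_image (\<gamma> {x,y}) \<subseteq> \<phi> ` ({u,v} \<inter> {x,y}))"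

definition planar :: "'a pair_pre_digraph \<Rightarrow> bool" where
  "planar G \<longleftrightarrow> (\<exists>\<phi> \<gamma>. plane_embedding G \<phi> \<gamma>)"

end

theory Submission
  imports Defs
begin

text \<open>In a subdivided \<open>K\<^sub>4\<close> some cycle has length \<open>\<equiv> 0\<close> or \<open>\<equiv> 3 (mod 4)\<close>: if the three cycles of a
  theta graph have lengths \<open>\<equiv> 1, 2\<close>, then at most one of its three paths has even length, and
  this parity condition cannot hold for all six theta graphs inside a \<open>K\<^sub>4\<close>. A graph of minimum
  degree at least three contains a subdivided \<open>K\<^sub>4\<close>, found on a longest path. Hence some vertex
  has degree at most two. Suppressing it, and giving the new edge the sum of the two old lengths,
  preserves the condition on cycles, so the graph is a subgraph of a 2-tree. A 2-tree is drawn with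
  straight lines by putting each new vertex close to the midpoint of the edge it is attached to.\<close>

section \<open>Weighted cycles\<close>

fun walk_weight :: "('a \<Rightarrow> 'a \<Rightarrow> nat) \<Rightarrow> 'a list \<Rightarrow> nat" where
  "walk_weight w (x # y # zs) = w x y + walk_weight w (y # zs)"
| "walk_weight w _ = 0"

lemma walk_weight_append:
  "walk_weight w (xs @ y # ys) = walk_weight w (xs @ [y]) + walk_weight w (y # ys)"
  by (induction w xs rule: walk_weight.induct) auto

lemma walk_weight_append2:
  assumes "xs \<noteq> []" "ys \<noteq> []"
  shows "walk_weight w (xs @ ys) = walk_weight w xs + w (last xs) (hd ys) + walk_weight w ys"
  using assms
proof (induction xs rule: induct_list012)
  case (2 x)
  then show ?case by (cases ys) auto
qed auto

lemma walk_weight_snoc2: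
  "walk_weight w (xs @ [x, y]) = walk_weight w (xs @ [x]) + w x y"
  using walk_weight_append[of w xs x "[y]"] by simp

lemma walk_weight_rev:
  assumes "\<And>x y. w x y = w y x"
  shows "walk_weight w (rev xs) = walk_weight w xs"
proof (induction xs)
  case (Cons x xs)
  then show ?case
    using assms by (cases xs) (auto simp: walk_weight_snoc2)
qed simp

lemma walk_weight_cong:
  assumes "successively (\<lambda>x y. w x y = w' x y) xs"
  shows "walk_weight w xs = walk_weight w' xs"
  using assms by (induction w xs rule: walk_weight.induct) auto

text \<open>The list goes around once and does not repeat its first vertex; the edge from
  \<open>last xs\<close> to \<open>hd xs\<close> is kept apart. A rotation swaps two segments of the
  list, so any chosen edge can be made the closing one.\<close>

definition vertex_cycle :: "('a \<Rightarrow> 'a \<Rightarrow> bool) \<Rightarrow> 'a list \<Rightarrow> bool" where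
  "vertex_cycle E xs \<longleftrightarrow>
     3 \<le> length xs \<and> distinct xs \<and> successively E xs \<and> E (last xs) (hd xs)"

definition cycle_weight :: "('a \<Rightarrow> 'a \<Rightarrow> nat) \<Rightarrow> 'a list \<Rightarrow> nat" where
  "cycle_weight w xs = walk_weight w xs + w (last xs) (hd xs)"

lemma vertex_cycle_rotate:
  assumes "vertex_cycle E (xs @ ys)"
  shows "vertex_cycle E (ys @ xs)"
  using assms
  by (cases "xs = []"; cases "ys = []") (auto simp: vertex_cycle_def successively_append_iff)

lemma cycle_weight_rotate: "cycle_weight w (ys @ xs) = cycle_weight w (xs @ ys)"
  by (cases "xs = []"; cases "ys = []") (auto simp: cycle_weight_def walk_weight_append2)

section \<open>Parity in theta graphs and in subdivided K4\<close>

text \<open>\<open>a\<close>, \<open>b\<close>, \<open>c\<close> are the lengths of the three paths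
  of a theta graph. If \<open>a\<close> and \<open>b\<close> were even, then \<open>a + b\<close>
  would be 2 mod 4 and so would the difference of \<open>a\<close> and \<open>b\<close>; but
  \<open>a + c\<close> and \<open>b + c\<close>, both being 1 or 2, cannot differ by 2 mod 4. The
  proof runs through the residues.\<close>

lemma theta_parity:
  fixes a b c :: nat
  assumes "(a + b) mod 4 \<in> {1, 2}" "(b + c) mod 4 \<in> {1, 2}" "(a + c) mod 4 \<in> {1, 2}"
  shows "(odd a \<or> odd b) \<and> (odd b \<or> odd c) \<and> (odd a \<or> odd c)"
proof -
  have residue: "n mod 4 \<in> {0, 1, 2, 3}" for n :: nat
    by auto
  have "\<forall>x \<in> {0, 1, 2, 3 :: nat}. \<forall>y \<in> {0, 1, 2, 3}. \<forall>z \<in> {0, 1, 2, 3}.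
      (x + y) mod 4 \<in> {1, 2} \<longrightarrow> (y + z) mod 4 \<in> {1, 2} \<longrightarrow> (x + z) mod 4 \<in> {1, 2} \<longrightarrow>
      (odd x \<or> odd y) \<and> (odd y \<or> odd z) \<and> (odd x \<or> odd z)"
    by simp
  from this[rule_format, OF residue[of a] residue[of b] residue[of c]] assms
  have "(odd (a mod 4) \<or> odd (b mod 4)) \<and> (odd (b mod 4) \<or> odd (c mod 4)) \<and>
      (odd (a mod 4) \<or> odd (c mod 4))"
    unfolding mod_add_eq by blast
  moreover have "even (n mod 4) \<longleftrightarrow> even n" for n :: nat
    by (simp add: dvd_mod_iff)
  ultimately show ?thesis
    by simp
qed

lemma successively_append_Cons:
  "successively P (xs @ y # ys) \<longleftrightarrow> successively P (xs @ [y]) \<and> successively P (y # ys)"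
  by (auto simp: successively_append_iff)

text \<open>Weights stand for the lengths of paths that have been replaced by single edges. This
  keeps the class closed under suppressing a vertex.\<close>

locale mod4_weighted_graph =
  fixes V :: "'a set" and E :: "'a \<Rightarrow> 'a \<Rightarrow> bool" and w :: "'a \<Rightarrow> 'a \<Rightarrow> nat"
  assumes finite_verts: "finite V"
    and edge_verts: "E x y \<Longrightarrow> x \<in> V \<and> y \<in> V \<and> x \<noteq> y"
    and edge_sym: "E x y \<Longrightarrow> E y x"
    and weight_sym: "w x y = w y x"
    and weight_mod: "vertex_cycle E xs \<Longrightarrow> cycle_weight w xs mod 4 \<in> {1, 2}"
begin

lemma successively_rev_edge: "successively E (rev xs) \<longleftrightarrow> successively E xs"
  unfolding successively_rev using edge_sym by (intro successively_cong) auto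

text \<open>The vertices \<open>x\<close>, \<open>y\<close>, \<open>z\<close>, \<open>t\<close> are the branch vertices of a subdivided \<open>K\<^sub>4\<close>. The path
  from \<open>y\<close> to \<open>t\<close> passes through \<open>D\<close>, which may be empty.\<close>

lemma no_subdivided_K4:
  assumes P: "distinct (x # A @ y # z # B @ t # D)" "successively E (x # A @ y # z # B @ t # D)"
    and xz: "E x z" and xt: "E x t" and yD: "E y (last (t # D))"
  shows False
proof -
  define e where "e = last (t # D)"
  \<comment> \<open>Three branches of the K4: \<open>\<alpha>\<close> joins \<open>x\<close> to
    \<open>y\<close>, \<open>\<beta>\<close> joins \<open>z\<close> to \<open>t\<close>, and
    \<open>\<delta>\<close> joins \<open>t\<close> to \<open>y\<close> through \<open>D\<close> and
    the edge from \<open>e\<close> to \<open>y\<close>. The other three are the single edges from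
    \<open>x\<close> to \<open>z\<close>, from \<open>x\<close> to \<open>t\<close> and from
    \<open>y\<close> to \<open>z\<close>.\<close>
  define \<alpha> \<beta> \<delta> where "\<alpha> = walk_weight w (x # A @ [y])" and "\<beta> = walk_weight w (z # B @ [t])"
    and "\<delta> = walk_weight w (t # D) + w y e"
  have rev_D: "walk_weight w (rev D @ [t]) = walk_weight w (t # D)"
    using walk_weight_rev[OF weight_sym, where xs = "t # D"] by simp
  have hd_rev: "hd (rev D @ [t]) = e"
    by (simp add: e_def hd_append hd_rev)
  note split_suc = successively_append_Cons[of E "x # A" y, unfolded append_Cons]
    successively_append_Cons[of E "z # B" t, unfolded append_Cons]
    successively_append_Cons[of E "y # rev D" t, unfolded append_Cons]
  have suc: "successively E (x # A @ [y])" "E y z" "successively E (z # B @ [t])"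
     "successively E (t # D)"
    using P(2) split_suc(1)[of "z # B @ t # D"] split_suc(2)[of D] by auto
  have e: "E y e" "E e y" "e \<in> set (t # D)"
    using yD edge_sym by (auto simp: e_def)
  have suc_rev: "successively E (rev D @ [t])"
    using suc(4) successively_rev_edge[of "t # D"] by simp
  have suc_rev_B: "successively E (t # rev B @ [z])"
    using suc(3) successively_rev_edge[of "z # B @ [t]"] by simp
  have suc_y: "successively E (y # rev D @ [t])"
    using suc_rev hd_rev e(1) by (simp add: successively_Cons)
  \<comment> \<open>These are all seven cycles of the K4: each of \<open>c1\<close> to
    \<open>c4\<close> omits one branch vertex, \<open>c5\<close> to \<open>c7\<close> pass through
    all four.\<close>
  have c1: "vertex_cycle E (x # A @ [y, z])"
    using P(1) suc edge_sym[OF xz] split_suc(1)[of "[z]"] by (auto simp: vertex_cycle_def)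
  have c2: "vertex_cycle E (x # z # B @ [t])"
    using P(1) suc xz edge_sym[OF xt] by (auto simp: vertex_cycle_def)
  have c3: "vertex_cycle E (y # z # B @ t # D)"
    using P(1) suc e split_suc(2)[of D] by (auto simp: vertex_cycle_def e_def)
  have c4: "vertex_cycle E (x # A @ y # rev D @ [t])"
    using P(1) suc suc_y edge_sym[OF xt] split_suc(1)[of "rev D @ [t]"]
    by (auto simp: vertex_cycle_def)
  have c5: "vertex_cycle E (x # A @ y # z # B @ [t])"
    using P(1) suc edge_sym[OF xt] split_suc(1)[of "z # B @ [t]"] by (auto simp: vertex_cycle_def)
  have c6: "vertex_cycle E (x # A @ y # rev D @ t # rev B @ [z])"
    using P(1) suc suc_y suc_rev_B edge_sym[OF xz]
      split_suc(1)[of "rev D @ t # rev B @ [z]"] split_suc(3)[of "rev B @ [z]"]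
    by (auto simp: vertex_cycle_def)
  have c7: "vertex_cycle E (x # z # y # rev D @ [t])"
    using P(1) suc_y xz edge_sym[OF xt] edge_sym[OF suc(2)] by (auto simp: vertex_cycle_def)
  have wt_y: "walk_weight w (y # rev D @ [t]) = \<delta>"
    using walk_weight_append2[of "[y]" "rev D @ [t]" w] rev_D hd_rev by (simp add: \<delta>_def)
  have wt_z: "walk_weight w (t # rev B @ [z]) = \<beta>"
    using walk_weight_rev[OF weight_sym, where xs = "z # B @ [t]"] by (simp add: \<beta>_def)
  note split = walk_weight_append[of w "x # A" y] walk_weight_append[of w "z # B" t]
    walk_weight_append[of w "y # rev D" t]
  have w1: "cycle_weight w (x # A @ [y, z]) = \<alpha> + w y z + w x z"
    using split(1)[of "[z]"] by (simp add: cycle_weight_def \<alpha>_def weight_sym)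
  have w2: "cycle_weight w (x # z # B @ [t]) = w x z + \<beta> + w x t"
    by (simp add: cycle_weight_def \<beta>_def weight_sym)
  have w3: "cycle_weight w (y # z # B @ t # D) = w y z + \<beta> + \<delta>"
    using split(2)[of D] by (simp add: cycle_weight_def \<beta>_def \<delta>_def weight_sym e_def)
  have w4: "cycle_weight w (x # A @ y # rev D @ [t]) = \<alpha> + \<delta> + w x t"
    using split(1)[of "rev D @ [t]"] wt_y by (simp add: cycle_weight_def \<alpha>_def weight_sym)
  have w5: "cycle_weight w (x # A @ y # z # B @ [t]) = \<alpha> + w y z + \<beta> + w x t"
    using split(1)[of "z # B @ [t]"] by (simp add: cycle_weight_def \<alpha>_def \<beta>_def weight_sym)
  have w6: "cycle_weight w (x # A @ y # rev D @ t # rev B @ [z]) = \<alpha> + \<delta> + \<beta> + w x z"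
    using split(1)[of "rev D @ t # rev B @ [z]"] split(3)[of "rev B @ [z]"] wt_y wt_z
    by (simp add: cycle_weight_def \<alpha>_def weight_sym)
  have w7: "cycle_weight w (x # z # y # rev D @ [t]) = w x z + w y z + \<delta> + w x t"
    using wt_y by (simp add: cycle_weight_def weight_sym)
  note m = weight_mod[OF c1, unfolded w1] weight_mod[OF c2, unfolded w2]
    weight_mod[OF c3, unfolded w3] weight_mod[OF c4, unfolded w4] weight_mod[OF c5, unfolded w5]
    weight_mod[OF c6, unfolded w6] weight_mod[OF c7, unfolded w7]
  define a b c where "a = w x z" and "b = w y z" and "c = w x t"
  note m = m[folded a_def b_def c_def]
  note ac = add.assoc add.commute add.left_commute
  \<comment> \<open>Each line is the theta graph left after deleting one branch. If all branches
    were odd, every path of two branches would be even. If \<open>\<alpha>\<close> is even, the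
    first and fourth lines make the four branches next to it alternate in parity around their cycle,
    and then the second and third lines contradict each other. The other branches are alike by
    symmetry.\<close>
  have t: "(odd \<alpha> \<or> odd (a + b)) \<and> (odd (a + b) \<or> odd (c + \<delta>)) \<and> (odd \<alpha> \<or> odd (c + \<delta>))"
    "(odd a \<or> odd (\<alpha> + b)) \<and> (odd (\<alpha> + b) \<or> odd (c + \<beta>)) \<and> (odd a \<or> odd (c + \<beta>))"
    "(odd b \<or> odd (\<alpha> + a)) \<and> (odd (\<alpha> + a) \<or> odd (\<beta> + \<delta>)) \<and> (odd b \<or> odd (\<beta> + \<delta>))"
    "(odd \<beta> \<or> odd (a + c)) \<and> (odd (a + c) \<or> odd (b + \<delta>)) \<and> (odd \<beta> \<or> odd (b + \<delta>))"
    "(odd c \<or> odd (a + \<beta>)) \<and> (odd (a + \<beta>) \<or> odd (\<alpha> + \<delta>)) \<and> (odd c \<or> odd (\<alpha> + \<delta>))"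
    "(odd \<delta> \<or> odd (\<alpha> + c)) \<and> (odd (\<alpha> + c) \<or> odd (b + \<beta>)) \<and> (odd \<delta> \<or> odd (b + \<beta>))"
    by (rule theta_parity; insert m; simp only: ac)+
  then show False
    unfolding even_add by argo
qed

text \<open>On a longest path, let \<open>A\<close> be the initial segment cut off by the nearest neighbour \<open>hd B\<close> of
  \<open>hd A\<close> other than its successor, with \<open>A\<close> as short as possible among all longest paths. Reversing
  \<open>A\<close> gives another longest path, so both ends of \<open>A\<close> have a neighbour beyond \<open>hd B\<close>.\<close>

lemma exists_vertex_degree_le_2:
  assumes "V \<noteq> {}"
  shows "\<exists>v \<in> V. card {y. E v y} \<le> 2"
proof (rule ccontr)
  assume deg: "\<not> ?thesis"
  have third: "\<exists>u. E x u \<and> u \<noteq> p \<and> u \<noteq> q" if "x \<in> V" for x p q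
  proof (rule ccontr)
    assume "\<not> ?thesis"
    then have "{y. E x y} \<subseteq> {p, q}" by auto
    then have "card {y. E x y} \<le> card {p, q}"
      by (intro card_mono) auto
    also have "\<dots> \<le> 2"
      by (simp add: card_insert_if)
    finally show False
      using deg that by auto
  qed
  define is_path where "is_path P \<longleftrightarrow> distinct P \<and> successively E P \<and> set P \<subseteq> V" for P
  obtain v where "v \<in> V"
    using assms by auto
  then have single: "is_path [v]"
    by (simp add: is_path_def)
  have bound: "\<forall>P. is_path P \<longrightarrow> length P < Suc (card V)"
    using finite_verts by (metis card_mono distinct_card is_path_def less_Suc_eq_le)
  obtain L where L: "is_path L" "\<And>P. is_path P \<Longrightarrow> length P \<le> length L"
    using ex_has_greatest_nat[OF single bound] by auto
  \<comment> \<open>A neighbour off the path would extend a longest path.\<close>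
  have nbrs: "u \<in> set P" if "is_path P" "length P = length L" "P \<noteq> []" "E (hd P) u" for P u
  proof (rule ccontr)
    assume "u \<notin> set P"
    with that have "is_path (u # P)"
      using edge_verts edge_sym by (auto simp: is_path_def successively_Cons)
    from L(2)[OF this] that show False by simp
  qed
  \<comment> \<open>\<open>A\<close> and \<open>hd B\<close> form a cycle. With \<open>n = 1\<close>
    the closing edge would be the first edge of the path itself, hence the bound
    \<open>2 \<le> n\<close>.\<close>
  define lasso where "lasso n A B \<longleftrightarrow> is_path (A @ B) \<and> length (A @ B) = length L \<and>
      length A = n \<and> 2 \<le> n \<and> B \<noteq> [] \<and> E (hd A) (hd B)" for n A B
  have "\<exists>n A B. lasso n A B"
  proof -
    obtain x L' where x: "L = x # L'"
      using L(2)[OF single] by (cases L) auto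
    then have "x \<in> V"
      using L(1) by (simp add: is_path_def)
    from third[OF this] obtain u where u: "E x u" "u \<noteq> hd L'" by blast
    then have "u \<in> set L'"
      using nbrs[of L u] L(1) x edge_verts by auto
    then obtain C D where "L' = C @ u # D"
      by (meson split_list)
    moreover from this u(2) have "C \<noteq> []" by auto
    ultimately have "lasso (Suc (length C)) (x # C) (u # D)"
      using L(1) x u(1) by (cases C) (auto simp: lasso_def)
    then show ?thesis by blast
  qed
  define n where "n = (LEAST n. \<exists>A B. lasso n A B)"
  have n: "\<exists>A B. lasso n A B"
    unfolding n_def by (rule LeastI_ex) fact
  have least: "\<not> lasso m A B" if "m < n" for m A B
    using not_less_Least[OF that[unfolded n_def]] by blast
  \<comment> \<open>A third neighbour of \<open>hd A\<close>, besides its successor and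
    \<open>hd B\<close>, lies on the path. Inside \<open>A\<close> it would cut off a shorter lasso,
    against the choice of \<open>n\<close>.\<close>
  have far: "\<exists>u \<in> set (tl B). E (hd A) u" if AB: "lasso n A B" for A B
  proof -
    obtain x y A' where A: "A = x # y # A'"
      using AB by (cases A; cases "tl A") (auto simp: lasso_def)
    then have "x \<in> V"
      using AB by (auto simp: lasso_def is_path_def)
    from third[OF this] obtain u where u: "E x u" "u \<noteq> y" "u \<noteq> hd B" by blast
    then have "u \<in> set (A @ B)" "u \<noteq> x"
      using nbrs[of "A @ B" u] AB A edge_verts by (auto simp: lasso_def)
    moreover have False if uA: "u \<in> set A'"
    proof -
      obtain C D where "A' = C @ u # D"
        using uA by (meson split_list)
      then have "lasso (length C + 2) (x # y # C) (u # D @ B)"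
        using AB A u(1) by (auto simp: lasso_def)
      moreover have "length C + 2 < n"
        using AB A \<open>A' = C @ u # D\<close> by (auto simp: lasso_def)
      ultimately show False
        using least by blast
    qed
    ultimately have "u \<in> set (tl B)"
      using u A by (cases B) auto
    then show ?thesis
      using u(1) A by auto
  qed
  \<comment> \<open>The two edges that join the ends of \<open>A\<close> to \<open>hd B\<close>
    exchange roles: the closing edge becomes a path edge and the path edge closes the cycle.\<close>
  have rev_lasso: "lasso n (rev A) B" if AB: "lasso n A B" for A B
    using AB edge_sym successively_rev_edge[of A]
    by (auto simp: lasso_def is_path_def successively_append_iff hd_rev last_rev
        simp del: successively_rev)
  \<comment> \<open>The branch vertices are \<open>hd A\<close>, \<open>last A\<close>,
    \<open>z\<close> and \<open>t\<close>. The path is cut off after the neighbour \<open>s\<close>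
    of \<open>last A\<close>, which provides the last branch.\<close>
  have no_K4: False
    if AB: "lasso n A (z # B @ t # D)" and "E (hd A) t" "E (last A) s" "s \<in> set (t # D)"
    for A B z t D s
  proof -
    obtain D1 D2 where D: "D = D1 @ D2" "s = last (t # D1)"
    proof (cases "s = t")
      case True
      then show ?thesis using that[of "[]" D] by simp
    next
      case False
      then obtain C D2 where "D = C @ s # D2"
        using \<open>s \<in> set (t # D)\<close> by (metis set_ConsD split_list)
      then show ?thesis using that[of "C @ [s]" D2] by simp
    qed
    obtain x A' where "A = x # A'" "A' \<noteq> []"
      using AB by (cases A; cases "tl A") (auto simp: lasso_def)
    then obtain A1 y where A: "A = x # A1 @ [y]"
      by (metis rev_exhaust)
    have "is_path ((x # A1 @ y # z # B @ t # D1) @ D2)"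
      using AB A D by (simp add: lasso_def)
    then have "distinct (x # A1 @ y # z # B @ t # D1)"
        "successively E (x # A1 @ y # z # B @ t # D1)"
      unfolding is_path_def successively_append_iff distinct_append by blast+
    then show False
      by (rule no_subdivided_K4) (use AB A that D in \<open>auto simp: lasso_def\<close>)
  qed
  from n obtain A B where AB: "lasso n A B" by blast
  then obtain z B' where B: "B = z # B'"
    by (cases B) (auto simp: lasso_def)
  obtain u where u: "u \<in> set B'" "E (hd A) u"
    using far[OF AB] B by auto
  obtain u' where u': "u' \<in> set B'" "E (last A) u'"
    using far[OF rev_lasso[OF AB]] B by (auto simp: hd_rev)
  obtain B1 D where D: "B' = B1 @ u # D"
    using u(1) by (meson split_list)
  \<comment> \<open>Whichever of \<open>u\<close> and \<open>u'\<close> comes first after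
    \<open>z\<close> has to serve as \<open>t\<close>. If it is \<open>u'\<close>, reversing
    \<open>A\<close> swaps the two ends.\<close>
  show False
  proof (cases "u' \<in> set (u # D)")
    case True
    then show False
      using no_K4[of A z B1 u D u'] AB B D u u' by auto
  next
    case False
    then have "u' \<in> set B1"
      using u' D by auto
    then obtain C D' where "B1 = C @ u' # D'"
      by (meson split_list)
    then show False
      using no_K4[of "rev A" z C u' "D' @ u # D" u] rev_lasso[OF AB] B D u u'
      by (auto simp: hd_rev last_rev)
  qed
qed

lemma mod4_weighted_graph_delete:
  "mod4_weighted_graph (V - {v}) (\<lambda>x y. E x y \<and> x \<noteq> v \<and> y \<noteq> v) w"
proof
  fix xs
  assume "vertex_cycle (\<lambda>x y. E x y \<and> x \<noteq> v \<and> y \<noteq> v) xs"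
  then have "vertex_cycle E xs"
    unfolding vertex_cycle_def by (auto elim: successively_mono)
  then show "cycle_weight w xs mod 4 \<in> {1, 2}"
    by (rule weight_mod)
qed (use finite_verts edge_verts edge_sym weight_sym in auto)

end

section \<open>Suppressing a vertex of degree two\<close>

lemma successively_conjI:
  assumes "successively P xs" "successively Q xs" "\<And>x y. P x y \<Longrightarrow> Q x y \<Longrightarrow> R x y"
  shows "successively R xs"
  using assms by (induction xs rule: induct_list012) auto

text \<open>With at least three distinct entries, the two ends are not consecutive in the list. Thus
  a cycle closed by the new edge uses that edge nowhere else.\<close>

lemma successively_neq_ends:
  assumes "distinct xs" "3 \<le> length xs"
  shows "successively (\<lambda>x y. {x, y} \<noteq> {last xs, hd xs}) xs"
proof -
  have "xs \<noteq> []"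
    using assms by auto
  then have ends: "last xs = xs ! (length xs - 1)" "hd xs = xs ! 0"
    by (auto simp: last_conv_nth hd_conv_nth)
  have index: "xs ! i = xs ! j \<longleftrightarrow> i = j" if "i < length xs" "j < length xs" for i j
    using that assms(1) by (simp add: nth_eq_iff_index_eq)
  show ?thesis
    unfolding successively_conv_nth ends
  proof (intro allI impI notI)
    fix i
    assume i: "Suc i < length xs" "{xs ! i, xs ! Suc i} = {xs ! (length xs - 1), xs ! 0}"
    have less: "i < length xs" "length xs - 1 < length xs" "0 < length xs"
      using i(1) by linarith+
    have "i = length xs - 1 \<and> Suc i = 0 \<or> i = 0 \<and> Suc i = length xs - 1"
      using i(2) unfolding doubleton_eq_iff
      by (simp only: index[OF less(1,2)] index[OF less(1,3)] index[OF i(1) less(2)]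
          index[OF i(1) less(3)])
    then show False
      using assms(2) i(1) by linarith
  qed
qed

lemma not_successivelyE:
  assumes "\<not> successively P xs"
  obtains ys x y zs where "xs = ys @ x # y # zs" "\<not> P x y"
  using assms
proof (induction xs arbitrary: thesis rule: induct_list012)
  case (3 x y zs)
  show ?case
  proof (cases "P x y")
    case True
    then have "\<not> successively P (y # zs)"
      using 3 by auto
    then obtain ys u v ws where "y # zs = ys @ u # v # ws" "\<not> P u v"
      using "3.IH"(2) by blast
    then show ?thesis
      using "3.prems"(1)[of "x # ys"] by simp
  next
    case False
    then show ?thesis
      using "3.prems"(1)[of "[]"] by simp
  qed
qed auto

lemma vertex_cycle_incident:
  assumes "vertex_cycle E xs" "x \<in> set xs"
  shows "\<exists>y. E x y \<or> E y x"
proof -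
  obtain ys zs where xs: "xs = ys @ x # zs"
    using assms(2) by (meson split_list)
  then have "vertex_cycle E (x # zs @ ys)"
    using vertex_cycle_rotate assms(1) by fastforce
  then show ?thesis
    by (cases "zs @ ys") (auto simp: vertex_cycle_def)
qed

context mod4_weighted_graph
begin

text \<open>A cycle through the new edge turns into an old cycle of equal weight by the detour over
  \<open>v\<close>. If \<open>a\<close> and \<open>b\<close> are adjacent already, the new weight
  overwrites the old one, so the new graph stays simple.\<close>

lemma mod4_weighted_graph_suppress:
  assumes "E v a" "E v b" "a \<noteq> b"
  shows "mod4_weighted_graph (V - {v}) (\<lambda>x y. E x y \<and> x \<noteq> v \<and> y \<noteq> v \<or> {x, y} = {a, b})
    (\<lambda>x y. if {x, y} = {a, b} then w a v + w v b else w x y)"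
    (is "mod4_weighted_graph _ ?E ?w")
proof
  let ?new = "\<lambda>x y. {x, y} = {a, b}"
  have old_edge: "E x y" if "?E x y" "{x, y} \<noteq> {a, b}" for x y
    using that by auto
  \<comment> \<open>If the new edge closes the cycle, appending \<open>v\<close> to the list inserts
    the detour.\<close>
  have closing: "cycle_weight ?w xs mod 4 \<in> {1, 2}"
    if xs: "vertex_cycle ?E xs" and ends: "?new (last xs) (hd xs)" for xs
  proof -
    have len: "distinct xs" "3 \<le> length xs" "xs \<noteq> []" "successively ?E xs"
      using xs by (auto simp: vertex_cycle_def)
    then have no_new: "successively (\<lambda>x y. {x, y} \<noteq> {a, b}) xs"
      using successively_neq_ends[of xs] ends by simp
    have "successively E xs"
      using len(4) no_new by (rule successively_conjI) (rule old_edge)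
    moreover have "v \<notin> set xs"
      using vertex_cycle_incident[OF xs] assms edge_verts by (fastforce simp: doubleton_eq_iff)
    moreover have "E (last xs) v" "E v (hd xs)"
      using ends assms edge_sym by (auto simp: doubleton_eq_iff)
    ultimately have "vertex_cycle E (xs @ [v])"
      using len by (auto simp: vertex_cycle_def successively_append_iff)
    from weight_mod[OF this] have "cycle_weight w (xs @ [v]) mod 4 \<in> {1, 2}" .
    moreover have "walk_weight ?w xs = walk_weight w xs"
      by (rule walk_weight_cong, rule successively_mono[OF no_new]) auto
    moreover have "w (last xs) v + w v (hd xs) = w a v + w v b"
      using ends weight_sym by (auto simp: doubleton_eq_iff)
    ultimately show ?thesis
      using ends len(3) by (simp add: cycle_weight_def walk_weight_append2 add.assoc)
  qed
  fix xs
  assume xs: "vertex_cycle ?E xs"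
  show "cycle_weight ?w xs mod 4 \<in> {1, 2}"
  proof (cases "successively (\<lambda>x y. {x, y} \<noteq> {a, b}) xs")
    case True
    show ?thesis
    proof (cases "?new (last xs) (hd xs)")
      case True
      then show ?thesis using closing xs by blast
    next
      case False
      have "successively E xs"
        using xs True by (auto simp: vertex_cycle_def intro: successively_conjI old_edge)
      then have "vertex_cycle E xs"
        using xs False old_edge unfolding vertex_cycle_def by blast
      moreover have "walk_weight ?w xs = walk_weight w xs"
        by (rule walk_weight_cong, rule successively_mono[OF True]) auto
      ultimately show ?thesis
        using weight_mod[of xs] False by (simp add: cycle_weight_def)
    qed
  next
    case False
    \<comment> \<open>The new edge lies inside the list; a rotation makes it the closing
      edge.\<close>
    then obtain ys x y zs where split: "xs = ys @ x # y # zs" "{x, y} = {a, b}"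
      by (rule not_successivelyE) auto
    have "vertex_cycle ?E ((y # zs) @ (ys @ [x]))"
      using xs split vertex_cycle_rotate[of ?E "ys @ [x]" "y # zs"] by simp
    moreover have "?new (last ((y # zs) @ (ys @ [x]))) (hd ((y # zs) @ (ys @ [x])))"
      using split by simp
    ultimately have "cycle_weight ?w ((y # zs) @ (ys @ [x])) mod 4 \<in> {1, 2}"
      by (rule closing)
    then show ?thesis
      using split cycle_weight_rotate[of ?w "y # zs" "ys @ [x]"] by simp
  qed
qed (use finite_verts edge_verts edge_sym weight_sym assms in
    \<open>auto simp: doubleton_eq_iff insert_commute\<close>)

end

section \<open>2-trees\<close>

text \<open>The single edge counts as the smallest 2-tree, so that inductions start at two vertices.
  Subgraphs of 2-trees are the graphs of treewidth at most two.\<close>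

inductive two_tree :: "'a set \<Rightarrow> 'a set set \<Rightarrow> bool" where
  edge: "a \<noteq> b \<Longrightarrow> two_tree {a, b} {{a, b}}"
| attach: "two_tree V F \<Longrightarrow> {a, b} \<in> F \<Longrightarrow> a \<noteq> b \<Longrightarrow> v \<notin> V \<Longrightarrow>
    two_tree (insert v V) (insert {v, a} (insert {v, b} F))"

lemma two_tree_edge:
  assumes "two_tree V F" "e \<in> F"
  shows "\<exists>a b. e = {a, b} \<and> a \<noteq> b \<and> a \<in> V \<and> b \<in> V"
  using assms
proof (induction arbitrary: e rule: two_tree.induct)
  case (attach V F a b v)
  from attach.IH[OF \<open>{a, b} \<in> F\<close>] have "a \<in> V" "b \<in> V"
    by (auto simp: doubleton_eq_iff)
  then have "v \<noteq> a" "v \<noteq> b"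
    using \<open>v \<notin> V\<close> by auto
  from attach.prems consider "e = {v, a}" | "e = {v, b}" | "e \<in> F"
    by blast
  then show ?case
  proof cases
    case 3
    from attach.IH[OF this] show ?thesis by blast
  qed (use \<open>a \<in> V\<close> \<open>b \<in> V\<close> \<open>v \<noteq> a\<close> \<open>v \<noteq> b\<close> in blast)+
qed auto

lemma two_tree_finite: "two_tree V F \<Longrightarrow> finite V \<and> finite F"
  by (induction rule: two_tree.induct) auto

text \<open>Provides an edge to which a vertex with at most one neighbour can be attached.\<close>

lemma two_tree_incident:
  assumes "two_tree V F" "a \<in> V"
  shows "\<exists>b. b \<noteq> a \<and> {a, b} \<in> F"
  using assms
proof (induction rule: two_tree.induct)
  case (edge a' b')
  then show ?case by (auto simp: insert_commute)
next
  case (attach V F a' b' v)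
  have "v \<noteq> a'"
    using two_tree_edge[OF attach.hyps(1,2)] attach.hyps(4) by (auto simp: doubleton_eq_iff)
  then show ?case
    using attach by auto
qed

text \<open>Remove a vertex with at most two neighbours, place the rest in a 2-tree by induction,
  and attach the vertex to an edge containing its neighbours. Suppression ensures that two
  neighbours form such an edge; since it changes the weights, the induction is over all
  \<open>w\<close>.\<close>

lemma mod4_weighted_graph_sub_two_tree:
  assumes "mod4_weighted_graph V E w" "2 \<le> card V"
  shows "\<exists>F. two_tree V F \<and> (\<forall>x y. E x y \<longrightarrow> {x, y} \<in> F)"
  using assms
proof (induction "card V" arbitrary: V E w rule: less_induct)
  case less
  interpret mod4_weighted_graph V E w
    by (rule less.prems(1))
  show ?case
  proof (cases "card V = 2")
    case True
    then obtain a b where "V = {a, b}" "a \<noteq> b"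
      by (auto simp: card_2_iff)
    then show ?thesis
      using two_tree.edge[of a b] edge_verts by (intro exI[of _ "{{a, b}}"]) fastforce
  next
    case False
    obtain v where v: "v \<in> V" "card {y. E v y} \<le> 2"
      using exists_vertex_degree_le_2 less.prems(2) by fastforce
    have smaller: "card (V - {v}) < card V" "2 \<le> card (V - {v})"
      using v(1) finite_verts less.prems(2) False by (auto simp: card_Diff_singleton card_gt_0_iff)
    have fin: "finite {y. E v y}"
      using finite_verts edge_verts by (auto intro: finite_subset)
    have "\<exists>F a b. two_tree (V - {v}) F \<and> (\<forall>x y. E x y \<and> x \<noteq> v \<and> y \<noteq> v \<longrightarrow> {x, y} \<in> F) \<and>
        {a, b} \<in> F \<and> a \<noteq> b \<and> {y. E v y} \<subseteq> {a, b}"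
    proof (cases "card {y. E v y} = 2")
      case True
      then obtain a b where ab: "{y. E v y} = {a, b}" "a \<noteq> b"
        by (auto simp: card_2_iff)
      then have "mod4_weighted_graph (V - {v}) (\<lambda>x y. E x y \<and> x \<noteq> v \<and> y \<noteq> v \<or> {x, y} = {a, b})
          (\<lambda>x y. if {x, y} = {a, b} then w a v + w v b else w x y)"
        by (intro mod4_weighted_graph_suppress) auto
      from less.hyps[OF smaller(1) this smaller(2)]
      obtain F where F: "two_tree (V - {v}) F"
          "\<forall>x y. E x y \<and> x \<noteq> v \<and> y \<noteq> v \<or> {x, y} = {a, b} \<longrightarrow> {x, y} \<in> F"
        by (elim exE conjE)
      show ?thesis
        by (rule exI[of _ F], rule exI[of _ a], rule exI[of _ b]) (use F ab in auto)
    next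
      case False
      from less.hyps[OF smaller(1) mod4_weighted_graph_delete smaller(2)]
      obtain F where F: "two_tree (V - {v}) F" "\<forall>x y. E x y \<and> x \<noteq> v \<and> y \<noteq> v \<longrightarrow> {x, y} \<in> F"
        by blast
      have "card {y. E v y} = 0 \<or> card {y. E v y} = 1"
        using v(2) False by linarith
      \<comment> \<open>Without neighbours of \<open>v\<close>, any remaining vertex can act as
        \<open>a\<close>.\<close>
      then have "\<exists>a \<in> V - {v}. {y. E v y} \<subseteq> {a}"
      proof
        assume "card {y. E v y} = 0"
        moreover have "V - {v} \<noteq> {}"
          using smaller(2) by force
        ultimately show ?thesis
          using fin by auto
      next
        assume "card {y. E v y} = 1"
        then obtain a where "{y. E v y} = {a}"
          by (auto simp: card_1_singleton_iff)
        then show ?thesis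
          using edge_verts by blast
      qed
      then obtain a where a: "a \<in> V - {v}" "{y. E v y} \<subseteq> {a}" by blast
      from two_tree_incident[OF F(1) a(1)] obtain b where "b \<noteq> a" "{a, b} \<in> F" by blast
      then show ?thesis
        using F a(2) by blast
    qed
    then obtain F a b where F: "two_tree (V - {v}) F"
        "\<forall>x y. E x y \<and> x \<noteq> v \<and> y \<noteq> v \<longrightarrow> {x, y} \<in> F"
        "{a, b} \<in> F" "a \<noteq> b" "{y. E v y} \<subseteq> {a, b}"
      by blast
    have "two_tree (insert v (V - {v})) (insert {v, a} (insert {v, b} F))"
      by (rule two_tree.attach[OF F(1,3,4)]) simp
    moreover have "{x, y} \<in> insert {v, a} (insert {v, b} F)" if "E x y" for x y
    proof -
      consider "x = v" | "y = v" | "x \<noteq> v" "y \<noteq> v" by blast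
      then show ?thesis
      proof cases
        case 2
        then have "x \<in> {a, b}"
          using F(5) edge_sym that by blast
        then show ?thesis
          using 2 by (auto simp: insert_commute)
      qed (use F that in auto)
    qed
    moreover have "insert v (V - {v}) = V"
      using v(1) by blast
    ultimately show ?thesis
      by auto
  qed
qed

section \<open>Straight-line drawings\<close>

text \<open>\<open>s\<close> and \<open>t\<close> are coordinates along \<open>b - a\<close> and
  \<open>n\<close> with origin \<open>a\<close>. The apex has coordinates 1/2 and
  \<open>\<epsilon>\<close>, so the side from \<open>a\<close> to the apex has slope
  \<open>2 * \<epsilon>\<close>, which gives the last bound.\<close>

lemma in_thin_triangleE:
  fixes a b n :: "'a::real_inner"
  assumes x: "x \<in> convex hull {a, b, midpoint a b + \<epsilon> *\<^sub>R n}" and "0 \<le> \<epsilon>"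
  obtains s t where "x = a + s *\<^sub>R (b - a) + t *\<^sub>R n" "0 \<le> s" "s \<le> 1" "0 \<le> t" "t \<le> \<epsilon>"
    "t \<le> 2 * \<epsilon> * s"
proof -
  obtain u v where uv: "x = a + u *\<^sub>R (b - a) + v *\<^sub>R (midpoint a b + \<epsilon> *\<^sub>R n - a)"
      "0 \<le> u" "0 \<le> v" "u + v \<le> 1"
    using x unfolding convex_hull_3_alt by auto
  have mid: "midpoint a b - a = (1 / 2) *\<^sub>R (b - a)"
    by (simp add: midpoint_def algebra_simps flip: scaleR_add_left)
  have "v *\<^sub>R (midpoint a b + \<epsilon> *\<^sub>R n - a) = v *\<^sub>R ((midpoint a b - a) + \<epsilon> *\<^sub>R n)"
    by (simp add: algebra_simps)
  also have "\<dots> = (v / 2) *\<^sub>R (b - a) + (\<epsilon> * v) *\<^sub>R n"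
    unfolding mid by (simp add: scaleR_add_right mult.commute)
  finally have "x = a + (u + v / 2) *\<^sub>R (b - a) + (\<epsilon> * v) *\<^sub>R n"
    unfolding uv(1) by (simp add: scaleR_add_left)
  moreover have "\<epsilon> * v \<le> 2 * \<epsilon> * (u + v / 2)"
    using uv assms(2) by (simp add: algebra_simps)
  moreover have "\<epsilon> * v \<le> \<epsilon>"
    using uv assms(2) by (simp add: mult_left_le)
  ultimately show ?thesis
    using that[of "u + v / 2" "\<epsilon> * v"] uv assms(2) by simp
qed

text \<open>\<open>K\<close> has a positive distance from the segment, while all points of the
  triangle are within \<open>\<epsilon> * norm n\<close> of it.\<close>

lemma eventually_thin_triangle_disjoint:
  fixes a b n :: "'a::euclidean_space"
  assumes K: "compact K" "K \<inter> closed_segment a b = {}"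
  shows "\<forall>\<^sub>F \<epsilon> in at_right 0. K \<inter> convex hull {a, b, midpoint a b + \<epsilon> *\<^sub>R n} = {}"
proof -
  obtain d where d: "0 < d" "\<And>x y. x \<in> K \<Longrightarrow> y \<in> closed_segment a b \<Longrightarrow> d \<le> dist x y"
    using separate_compact_closed[OF K(1) closed_segment K(2)] by auto
  have "((\<lambda>\<epsilon>. \<epsilon> * norm n) \<longlongrightarrow> 0 * norm n) (at_right 0)"
    by (intro tendsto_intros)
  then have "\<forall>\<^sub>F \<epsilon> in at_right 0. \<epsilon> * norm n < d"
    by (rule order_tendstoD(2)) (use d in simp)
  moreover have "\<forall>\<^sub>F \<epsilon> in at_right 0. 0 < (\<epsilon>::real)"
    by (simp add: eventually_at_right_less)
  ultimately show ?thesis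
  proof eventually_elim
    case (elim \<epsilon>)
    have False if x: "x \<in> K" "x \<in> convex hull {a, b, midpoint a b + \<epsilon> *\<^sub>R n}" for x
    proof -
      obtain s t where st: "x = a + s *\<^sub>R (b - a) + t *\<^sub>R n" "0 \<le> s" "s \<le> 1" "0 \<le> t" "t \<le> \<epsilon>"
        using in_thin_triangleE[OF x(2)] elim by (metis less_imp_le)
      have "a + s *\<^sub>R (b - a) \<in> closed_segment a b"
        using st by (auto simp: closed_segment_def algebra_simps intro!: exI[of _ s])
      from d(2)[OF x(1) this] have "d \<le> t * norm n"
        using st by (simp add: dist_norm)
      also have "\<dots> \<le> \<epsilon> * norm n"
        using st by (intro mult_right_mono) auto
      finally show False
        using elim by simp
    qed
    then show ?case by blast
  qed
qed

text \<open>A common point other than \<open>a\<close> shows that the direction \<open>c - a\<close>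
  has slope between 0 and \<open>2 * \<epsilon>\<close> over \<open>b - a\<close>. For small
  \<open>\<epsilon>\<close> the slope must be 0, and then the two segments overlap beyond
  \<open>a\<close>.\<close>

lemma eventually_thin_triangle_common_endpoint:
  fixes a b n :: "'a::euclidean_space"
  assumes "a \<noteq> b" "n \<noteq> 0" "n \<bullet> (b - a) = 0" "closed_segment a c \<inter> closed_segment a b \<subseteq> {a}"
  shows "\<forall>\<^sub>F \<epsilon> in at_right 0.
    closed_segment a c \<inter> convex hull {a, b, midpoint a b + \<epsilon> *\<^sub>R n} \<subseteq> {a}"
proof -
  \<comment> \<open>\<open>S\<close> and \<open>T\<close> are the coefficients of the orthogonal
    projections of \<open>c - a\<close> to \<open>b - a\<close> and to \<open>n\<close>.\<close>
  define S where "S = (c - a) \<bullet> (b - a) / ((b - a) \<bullet> (b - a))"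
  define T where "T = (c - a) \<bullet> n / (n \<bullet> n)"
  have "((\<lambda>\<epsilon>. 2 * \<epsilon> * S) \<longlongrightarrow> 2 * 0 * S) (at_right 0)"
    by (intro tendsto_intros)
  then have "\<forall>\<^sub>F \<epsilon> in at_right 0. 0 < T \<longrightarrow> 2 * \<epsilon> * S < T"
    by (cases "0 < T") (auto dest: order_tendstoD(2))
  moreover have "\<forall>\<^sub>F \<epsilon> in at_right 0. 0 < (\<epsilon>::real)"
    by (simp add: eventually_at_right_less)
  ultimately show ?thesis
  proof eventually_elim
    case (elim \<epsilon>)
    have False if x: "x \<in> closed_segment a c" "x \<in> convex hull {a, b, midpoint a b + \<epsilon> *\<^sub>R n}"
      and "x \<noteq> a" for x
    proof -
      obtain s t where st: "x = a + s *\<^sub>R (b - a) + t *\<^sub>R n" "0 \<le> s" "0 \<le> t" "t \<le> 2 * \<epsilon> * s"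
        using in_thin_triangleE[OF x(2)] elim by (metis less_imp_le)
      obtain l where "0 \<le> l" "l \<le> 1" and l: "x = a + l *\<^sub>R (c - a)"
        using x(1) by (auto simp: closed_segment_def algebra_simps)
      with \<open>x \<noteq> a\<close> have "0 < l"
        by (cases "l = 0") auto
      have "c - a = (1 / l) *\<^sub>R (l *\<^sub>R (c - a))"
        using \<open>0 < l\<close> by simp
      also have "l *\<^sub>R (c - a) = s *\<^sub>R (b - a) + t *\<^sub>R n"
        using st(1) l by (metis add.assoc add_left_cancel)
      finally have ca: "c - a = (s / l) *\<^sub>R (b - a) + (t / l) *\<^sub>R n"
        by (simp add: scaleR_add_right)
      have "S = s / l"
        unfolding S_def ca using assms(1,3) by (simp add: inner_add_left)
      have "T = t / l"
        unfolding T_def ca using assms(2,3)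
        by (simp add: inner_add_left inner_commute[of "b - a" n])
      have "T \<le> 2 * \<epsilon> * S"
        using divide_right_mono[OF st(4), of l] \<open>0 < l\<close> \<open>S = s / l\<close> \<open>T = t / l\<close> by simp
      moreover have "0 \<le> T"
        using \<open>T = t / l\<close> st \<open>0 < l\<close> by simp
      ultimately have "T = 0"
        using elim by linarith
      then have cS: "c - a = S *\<^sub>R (b - a)"
        using ca \<open>S = s / l\<close> \<open>T = t / l\<close> by simp
      have "0 \<le> S"
        using \<open>S = s / l\<close> st \<open>0 < l\<close> by simp
      moreover have "S \<noteq> 0"
        using cS l \<open>x \<noteq> a\<close> by auto
      ultimately have "0 < S"
        by simp
      \<comment> \<open>This is whichever of \<open>b\<close> and \<open>c\<close> is nearer to
        \<open>a\<close>, so it lies on both segments.\<close>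
      define y where "y = a + min 1 S *\<^sub>R (b - a)"
      have "y \<in> closed_segment a b"
        using \<open>0 < S\<close> by (auto simp: y_def closed_segment_def algebra_simps intro!: exI[of _ "min 1 S"])
      moreover have "y = a + (min 1 S / S) *\<^sub>R (c - a)"
        using \<open>0 < S\<close> by (simp add: y_def cS)
      then have "y \<in> closed_segment a c"
        using \<open>0 < S\<close>
        by (auto simp: closed_segment_def algebra_simps intro!: exI[of _ "min 1 S / S"])
      moreover have "y \<noteq> a"
        using \<open>0 < S\<close> assms(1) by (simp add: y_def min_def)
      ultimately show False
        using assms(4) by blast
    qed
    then show ?case by blast
  qed
qed

text \<open>Otherwise the nonzero vector from the midpoint to the apex would be a multiple of
  \<open>b - a\<close> and hence orthogonal to itself.\<close>

lemma not_collinear_apex: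
  fixes a b n :: "'a::euclidean_space"
  assumes "a \<noteq> b" "n \<noteq> 0" "n \<bullet> (b - a) = 0" "\<epsilon> \<noteq> 0"
  shows "\<not> collinear {a, b, midpoint a b + \<epsilon> *\<^sub>R n}"
proof
  assume "collinear {a, b, midpoint a b + \<epsilon> *\<^sub>R n}"
  then obtain u v where uv: "midpoint a b + \<epsilon> *\<^sub>R n = u *\<^sub>R a + v *\<^sub>R b" "u + v = 1"
    using collinear_3_imp_in_affine_hull[OF _ assms(1)] unfolding affine_hull_2 by blast
  then have "u = 1 - v" by simp
  have mid: "midpoint a b = a + (1 / 2) *\<^sub>R (b - a)"
    by (simp add: midpoint_def algebra_simps flip: scaleR_add_left)
  have "\<epsilon> *\<^sub>R n = (midpoint a b + \<epsilon> *\<^sub>R n) - midpoint a b"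
    by simp
  also have "\<dots> = (v - 1 / 2) *\<^sub>R (b - a)"
    unfolding uv(1) unfolding mid \<open>u = 1 - v\<close> by (simp add: algebra_simps)
  finally have "\<epsilon> *\<^sub>R n = (v - 1 / 2) *\<^sub>R (b - a)" .
  then have "n \<bullet> (\<epsilon> *\<^sub>R n) = 0"
    using assms(3) by simp
  then show False
    using assms by simp
qed

section \<open>Drawing 2-trees\<close>

text \<open>For an edge the convex hull is the segment between its ends; written as a hull, it
  requires no order of the two ends.\<close>

definition straight_line_drawing ::
  "'a set \<Rightarrow> 'a set set \<Rightarrow> ('a \<Rightarrow> 'b::euclidean_space) \<Rightarrow> bool" where
  "straight_line_drawing V F \<phi> \<longleftrightarrow>
     inj_on \<phi> V \<and>
     (\<forall>e \<in> F. convex hull (\<phi> ` e) \<inter> \<phi> ` V \<subseteq> \<phi> ` e) \<and>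
     (\<forall>e \<in> F. \<forall>f \<in> F. e \<noteq> f \<longrightarrow> convex hull (\<phi> ` e) \<inter> convex hull (\<phi> ` f) \<subseteq> \<phi> ` (e \<inter> f))"

lemma exists_orthogonal_real2:
  fixes d :: "real^2"
  assumes "d \<noteq> 0"
  shows "\<exists>n. n \<noteq> 0 \<and> n \<bullet> d = 0"
proof (intro exI[of _ "vector [- d $ 2, d $ 1]"] conjI)
  show "vector [- d $ 2, d $ 1] \<noteq> (0 :: real^2)"
    using assms by (auto simp: vec_eq_iff forall_2)
  show "vector [- d $ 2, d $ 1] \<bullet> d = 0"
    by (simp add: inner_vec_def sum_2)
qed

text \<open>The new vertex is the apex of a triangle over the segment of \<open>a\<close> and
  \<open>b\<close>, so thin that older vertices and other edges meet it at most in \<open>A\<close>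
  and \<open>B\<close>. The new edges are two sides of this triangle.\<close>

lemma two_tree_straight_line_drawing:
  assumes "two_tree V F"
  shows "\<exists>\<phi> :: 'a \<Rightarrow> real^2. straight_line_drawing V F \<phi>"
  using assms
proof (induction rule: two_tree.induct)
  case (edge a b)
  have "inj_on (\<lambda>x. if x = a then 0 else axis 1 1 :: real^2) {a, b}"
    by (auto simp: inj_on_def axis_eq_0_iff)
  then show ?case
    unfolding straight_line_drawing_def by blast
next
  case (attach V F a b v)
  from attach.IH obtain \<phi> :: "'a \<Rightarrow> real^2" where \<phi>: "straight_line_drawing V F \<phi>" by blast
  then have inj: "inj_on \<phi> V"
    and verts: "\<And>e. e \<in> F \<Longrightarrow> convex hull (\<phi> ` e) \<inter> \<phi> ` V \<subseteq> \<phi> ` e"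
    and edges: "\<And>e f. e \<in> F \<Longrightarrow> f \<in> F \<Longrightarrow> e \<noteq> f \<Longrightarrow>
      convex hull (\<phi> ` e) \<inter> convex hull (\<phi> ` f) \<subseteq> \<phi> ` (e \<inter> f)"
    unfolding straight_line_drawing_def by auto
  have edgeE: "\<exists>x y. e = {x, y} \<and> x \<noteq> y \<and> x \<in> V \<and> y \<in> V" if "e \<in> F" for e
    using two_tree_edge[OF attach.hyps(1) that] .
  from edgeE[OF attach.hyps(2)] have ab: "a \<in> V" "b \<in> V"
    by (auto simp: doubleton_eq_iff)
  define A where "A = \<phi> a"
  define B where "B = \<phi> b"
  have "A \<noteq> B"
    using inj ab attach.hyps(3) by (auto simp: A_def B_def inj_on_def)
  then obtain n where n: "n \<noteq> 0" "n \<bullet> (B - A) = 0"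
    using exists_orthogonal_real2[of "B - A"] by auto
  define triangle where "triangle \<epsilon> = convex hull {A, B, midpoint A B + \<epsilon> *\<^sub>R n}" for \<epsilon>
  have hull_ab: "convex hull (\<phi> ` {a, b}) = closed_segment A B"
    by (simp add: segment_convex_hull A_def B_def)
  have ev_verts: "\<forall>\<^sub>F \<epsilon> in at_right 0. \<phi> x \<notin> triangle \<epsilon>" if "x \<in> V - {a, b}" for x
  proof -
    have "\<phi> x \<notin> closed_segment A B"
      using verts[OF attach.hyps(2)] inj that ab unfolding hull_ab by (auto simp: inj_on_def)
    then show ?thesis
      using eventually_thin_triangle_disjoint[of "{\<phi> x}" A B n] by (simp add: triangle_def)
  qed
  have ev_edges: "\<forall>\<^sub>F \<epsilon> in at_right 0. convex hull (\<phi> ` e) \<inter> triangle \<epsilon> \<subseteq> \<phi> ` (e \<inter> {a, b})"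
    if e: "e \<in> F - {{a, b}}" for e
  proof -
    obtain x y where xy: "e = {x, y}" "x \<noteq> y"
      using edgeE[of e] e by auto
    have meet: "convex hull (\<phi> ` e) \<inter> closed_segment A B \<subseteq> \<phi> ` (e \<inter> {a, b})"
      using edges[of e "{a, b}"] e attach.hyps(2) hull_ab by simp
    \<comment> \<open>An edge disjoint from \<open>{a, b}\<close> is kept away by compactness, an
      edge sharing one end by its slope there.\<close>
    consider "e \<inter> {a, b} = {}" | c where "e = {a, c}" "c \<notin> {a, b}" | c where "e = {b, c}" "c \<notin> {a, b}"
      using xy e by (cases "x \<in> {a, b}"; cases "y \<in> {a, b}") (auto simp: insert_commute)
    then show ?thesis
    proof cases
      case 1
      have "compact (convex hull (\<phi> ` e))"
        by (intro compact_convex_hull finite_imp_compact) (simp add: xy)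
      then show ?thesis
        using eventually_thin_triangle_disjoint[of "convex hull (\<phi> ` e)" A B n] meet 1
        by (simp add: triangle_def)
    next
      case 2
      then have "e \<inter> {a, b} = {a}" "convex hull (\<phi> ` e) = closed_segment A (\<phi> c)"
        by (auto simp: segment_convex_hull A_def)
      then show ?thesis
        using eventually_thin_triangle_common_endpoint[OF \<open>A \<noteq> B\<close> n, of "\<phi> c"] meet
        by (simp add: triangle_def A_def)
    next
      case 3
      then have "e \<inter> {a, b} = {b}" "convex hull (\<phi> ` e) = closed_segment B (\<phi> c)"
        by (auto simp: segment_convex_hull B_def)
      moreover have "n \<bullet> (A - B) = 0"
        using n(2) by (simp add: inner_diff_right)
      ultimately show ?thesis
        using eventually_thin_triangle_common_endpoint[OF \<open>A \<noteq> B\<close>[symmetric] n(1), of "\<phi> c"] meet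
        by (simp add: triangle_def B_def insert_commute midpoint_sym closed_segment_commute)
    qed
  qed
  \<comment> \<open>Finitely many conditions, each true for all small positive
    \<open>\<epsilon>\<close>, hold for a common one.\<close>
  have fin: "finite (V - {a, b})" "finite (F - {{a, b}})"
    using two_tree_finite[OF attach.hyps(1)] by auto
  have "\<forall>\<^sub>F \<epsilon> in at_right 0. 0 < (\<epsilon>::real)"
    by (simp add: eventually_at_right_less)
  moreover have "\<forall>\<^sub>F \<epsilon> in at_right 0. \<forall>x \<in> V - {a, b}. \<phi> x \<notin> triangle \<epsilon>"
    using fin(1) ev_verts by (intro eventually_ball_finite) auto
  moreover have "\<forall>\<^sub>F \<epsilon> in at_right 0. \<forall>e \<in> F - {{a, b}}.
      convex hull (\<phi> ` e) \<inter> triangle \<epsilon> \<subseteq> \<phi> ` (e \<inter> {a, b})"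
    using fin(2) ev_edges by (intro eventually_ball_finite) auto
  ultimately have "\<forall>\<^sub>F \<epsilon> in at_right 0. 0 < \<epsilon> \<and> (\<forall>x \<in> V - {a, b}. \<phi> x \<notin> triangle \<epsilon>) \<and>
      (\<forall>e \<in> F - {{a, b}}. convex hull (\<phi> ` e) \<inter> triangle \<epsilon> \<subseteq> \<phi> ` (e \<inter> {a, b}))"
    by (intro eventually_conj)
  from eventually_happens'[OF trivial_limit_at_right_real this] obtain \<epsilon> where "0 < \<epsilon>"
    and far_verts: "\<forall>x \<in> V - {a, b}. \<phi> x \<notin> triangle \<epsilon>"
    and far_edges: "\<forall>e \<in> F - {{a, b}}. convex hull (\<phi> ` e) \<inter> triangle \<epsilon> \<subseteq> \<phi> ` (e \<inter> {a, b})"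
    by (elim exE conjE)
  define p where "p = midpoint A B + \<epsilon> *\<^sub>R n"
  have nc: "\<not> collinear {A, B, p}"
    unfolding p_def using not_collinear_apex[OF \<open>A \<noteq> B\<close> n] \<open>0 < \<epsilon>\<close> by simp
  have tri: "triangle \<epsilon> = convex hull {A, B, p}"
    by (simp add: triangle_def p_def)
  have "p \<noteq> A" "p \<noteq> B"
    using nc by (auto simp: insert_commute)
  define SA where "SA = convex hull {p, A}"
  define SB where "SB = convex hull {p, B}"
  have sub: "SA \<subseteq> triangle \<epsilon>" "SB \<subseteq> triangle \<epsilon>" "p \<in> triangle \<epsilon>"
    unfolding SA_def SB_def tri by (auto intro!: hull_mono hull_inc)
  have ends: "p \<in> SA" "A \<in> SA" "p \<in> SB" "B \<in> SB" "A \<in> closed_segment A B" "B \<in> closed_segment A B"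
    by (auto simp: SA_def SB_def hull_inc)
  \<comment> \<open>Two sides of a nondegenerate triangle meet only in their common corner.\<close>
  have meets: "SA \<inter> closed_segment A B = {A}" "SB \<inter> closed_segment A B = {B}" "SA \<inter> SB = {p}"
    using Int_closed_segment[of A p B] Int_closed_segment[of B p A] Int_closed_segment[of p A B] nc
    unfolding SA_def SB_def segment_convex_hull by (auto simp: insert_commute)
  have "B \<notin> SA"
    using meets(1) ends(6) \<open>A \<noteq> B\<close> by (metis IntI singletonD)
  have "A \<notin> SB"
    using meets(2) ends(5) \<open>A \<noteq> B\<close> by (metis IntI singletonD)
  have "p \<notin> closed_segment A B"
    using meets(1) ends(1) \<open>p \<noteq> A\<close> by (metis IntI singletonD)
  have tri_verts: "triangle \<epsilon> \<inter> \<phi> ` V \<subseteq> {A, B}"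
    using far_verts by (auto simp: A_def B_def)
  have p_new: "p \<notin> \<phi> ` V"
    using tri_verts sub(3) \<open>p \<noteq> A\<close> \<open>p \<noteq> B\<close> by blast
  have p_edge: "p \<notin> convex hull (\<phi> ` e)" if "e \<in> F" for e
  proof (cases "e = {a, b}")
    case True
    then show ?thesis
      using hull_ab \<open>p \<notin> closed_segment A B\<close> by simp
  next
    case False
    then show ?thesis
      using far_edges[rule_format, of e] that sub(3) p_new ab by blast
  qed
  define \<psi> where "\<psi> = \<phi>(v := p)"
  have \<psi>_edge: "\<psi> ` e = \<phi> ` e" if "e \<subseteq> V" for e
    using that attach.hyps(4) by (auto simp: \<psi>_def)
  have sub_V: "e \<subseteq> V" if "e \<in> F" for e
    using edgeE[OF that] by auto
  have va: "\<psi> ` {v, a} = {p, A}" and vb: "\<psi> ` {v, b} = {p, B}"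
    using ab attach.hyps(4) by (auto simp: \<psi>_def A_def B_def)
  have \<psi>_V: "\<psi> ` insert v V = insert p (\<phi> ` V)"
    using attach.hyps(4) by (auto simp: \<psi>_def)
  \<comment> \<open>The edge \<open>{a, b}\<close> is itself a side of the triangle. For any other
    edge, \<open>far_edges\<close> leaves only \<open>A\<close> and \<open>B\<close>, and
    \<open>B\<close> is not on \<open>SA\<close>.\<close>
  have old_a: "convex hull (\<phi> ` e) \<inter> SA \<subseteq> \<psi> ` (e \<inter> {v, a})" if "e \<in> F" for e
  proof (cases "e = {a, b}")
    case True
    then show ?thesis
      using hull_ab meets(1) ab attach.hyps(4) by (auto simp: \<psi>_def A_def)
  next
    case False
    have "convex hull (\<phi> ` e) \<inter> SA \<subseteq> \<phi> ` (e \<inter> {a})"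
      using far_edges[rule_format, of e] that sub(1) \<open>B \<notin> SA\<close> False unfolding B_def by blast
    also have "\<dots> = \<psi> ` (e \<inter> {a})"
      using ab by (intro \<psi>_edge[symmetric]) auto
    finally show ?thesis by blast
  qed
  have old_b: "convex hull (\<phi> ` e) \<inter> SB \<subseteq> \<psi> ` (e \<inter> {v, b})" if "e \<in> F" for e
  proof (cases "e = {a, b}")
    case True
    then show ?thesis
      using hull_ab meets(2) ab attach.hyps(4) by (auto simp: \<psi>_def B_def)
  next
    case False
    have "convex hull (\<phi> ` e) \<inter> SB \<subseteq> \<phi> ` (e \<inter> {b})"
      using far_edges[rule_format, of e] that sub(2) \<open>A \<notin> SB\<close> False unfolding A_def by blast
    also have "\<dots> = \<psi> ` (e \<inter> {b})"
      using ab by (intro \<psi>_edge[symmetric]) auto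
    finally show ?thesis by blast
  qed
  have "straight_line_drawing (insert v V) (insert {v, a} (insert {v, b} F)) \<psi>"
    unfolding straight_line_drawing_def
  proof (intro conjI)
    show "inj_on \<psi> (insert v V)"
      using inj p_new attach.hyps(4) by (auto simp: \<psi>_def inj_on_def)
  next
    have "SA \<inter> insert p (\<phi> ` V) \<subseteq> {p, A}" "SB \<inter> insert p (\<phi> ` V) \<subseteq> {p, B}"
      using tri_verts sub \<open>B \<notin> SA\<close> \<open>A \<notin> SB\<close> by blast+
    moreover have "convex hull (\<phi> ` e) \<inter> insert p (\<phi> ` V) \<subseteq> \<phi> ` e" if "e \<in> F" for e
      using verts[OF that] p_edge[OF that] by blast
    ultimately show "\<forall>e \<in> insert {v, a} (insert {v, b} F).
        convex hull (\<psi> ` e) \<inter> \<psi> ` insert v V \<subseteq> \<psi> ` e"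
      unfolding \<psi>_V by (simp add: va[simplified] vb[simplified] \<psi>_edge sub_V SA_def SB_def)
  next
    have "convex hull (\<psi> ` e) \<inter> convex hull (\<psi> ` f) \<subseteq> \<psi> ` (e \<inter> f)"
      if "e \<in> F" "f \<in> F" "e \<noteq> f" for e f
      using edges[OF that] \<psi>_edge[of "e \<inter> f"] sub_V that by (simp add: \<psi>_edge le_infI1)
    moreover have "convex hull (\<psi> ` e) \<inter> convex hull (\<psi> ` {v, a}) \<subseteq> \<psi> ` (e \<inter> {v, a})"
      "convex hull (\<psi> ` e) \<inter> convex hull (\<psi> ` {v, b}) \<subseteq> \<psi> ` (e \<inter> {v, b})" if "e \<in> F" for e
      unfolding va vb using old_a[OF that] old_b[OF that] \<psi>_edge[OF sub_V[OF that]]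
      by (simp_all add: SA_def SB_def)
    moreover have "convex hull (\<psi> ` {v, a}) \<inter> convex hull (\<psi> ` {v, b}) \<subseteq> \<psi> ` ({v, a} \<inter> {v, b})"
      unfolding va vb using meets(3) by (auto simp: SA_def SB_def \<psi>_def)
    ultimately show "\<forall>e \<in> insert {v, a} (insert {v, b} F). \<forall>f \<in> insert {v, a} (insert {v, b} F).
        e \<noteq> f \<longrightarrow> convex hull (\<psi> ` e) \<inter> convex hull (\<psi> ` f) \<subseteq> \<psi> ` (e \<inter> f)"
      by (metis (no_types, lifting) Int_commute insertE)
  qed
  then show ?case by blast
qed

section \<open>Planarity\<close>

lemma straight_line_drawing_imp_planar:
  fixes \<phi> :: "'a \<Rightarrow> real^2"
  assumes \<phi>: "straight_line_drawing (pverts G) F \<phi>"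
    and G: "\<And>u v. (u, v) \<in> parcs G \<Longrightarrow> {u, v} \<in> F \<and> u \<noteq> v \<and> u \<in> pverts G \<and> v \<in> pverts G"
  shows "planar G"
proof -
  have inj: "inj_on \<phi> (pverts G)"
    and verts: "\<And>e. e \<in> F \<Longrightarrow> convex hull (\<phi> ` e) \<inter> \<phi> ` pverts G \<subseteq> \<phi> ` e"
    and edges: "\<And>e f. e \<in> F \<Longrightarrow> f \<in> F \<Longrightarrow> e \<noteq> f \<Longrightarrow>
      convex hull (\<phi> ` e) \<inter> convex hull (\<phi> ` f) \<subseteq> \<phi> ` (e \<inter> f)"
    using \<phi> by (auto simp: straight_line_drawing_def)
  \<comment> \<open>The curve belongs to an unordered pair, so one of its two orientations is
    chosen; the image and the set of ends are the same for both.\<close>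
  define \<gamma> where "\<gamma> e = (SOME g. \<exists>x y. e = {x, y} \<and> g = linepath (\<phi> x) (\<phi> y))" for e
  have \<gamma>: "\<gamma> {u, v} = linepath (\<phi> u) (\<phi> v) \<or> \<gamma> {u, v} = linepath (\<phi> v) (\<phi> u)" for u v
  proof -
    have "\<exists>g x y. {u, v} = {x, y} \<and> g = linepath (\<phi> x) (\<phi> y)"
      by blast
    from someI_ex[OF this] obtain x y where "{u, v} = {x, y}" "\<gamma> {u, v} = linepath (\<phi> x) (\<phi> y)"
      unfolding \<gamma>_def by blast
    then show ?thesis
      by (auto simp: doubleton_eq_iff)
  qed
  have image: "path_image (\<gamma> {u, v}) = convex hull (\<phi> ` {u, v})" for u v
    using \<gamma>[of u v] by (auto simp: segment_convex_hull insert_commute)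
  have "plane_embedding G \<phi> \<gamma>"
    unfolding plane_embedding_def
  proof (intro conjI ballI, goal_cases)
    case 1
    show ?case by (rule inj)
  next
    case (2 e)
    obtain u v where e: "e = (u, v)" by fastforce
    with 2 G have uv: "{u, v} \<in> F" "u \<noteq> v" "u \<in> pverts G" "v \<in> pverts G" by auto
    then have "\<phi> u \<noteq> \<phi> v"
      using inj by (auto simp: inj_on_def)
    then have "arc (\<gamma> {u, v})" "{pathstart (\<gamma> {u, v}), pathfinish (\<gamma> {u, v})} = {\<phi> u, \<phi> v}"
      using \<gamma>[of u v] by auto
    moreover have "path_image (\<gamma> {u, v}) \<inter> \<phi> ` pverts G = {\<phi> u, \<phi> v}"
    proof
      show "path_image (\<gamma> {u, v}) \<inter> \<phi> ` pverts G \<subseteq> {\<phi> u, \<phi> v}"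
        using verts[OF uv(1)] unfolding image by simp
      show "{\<phi> u, \<phi> v} \<subseteq> path_image (\<gamma> {u, v}) \<inter> \<phi> ` pverts G"
        using uv unfolding image by (auto intro!: hull_inc)
    qed
    ultimately show ?case
      by (simp add: e)
  next
    case (3 e)
    obtain u v where e: "e = (u, v)" by fastforce
    have "path_image (\<gamma> {u, v}) \<inter> path_image (\<gamma> {x, y}) \<subseteq> \<phi> ` ({u, v} \<inter> {x, y})"
      if "(x, y) \<in> parcs G" "{u, v} \<noteq> {x, y}" for x y
      unfolding image by (rule edges) (use G[of u v] G[of x y] 3 e that in auto)
    then show ?case
      by (auto simp: e simp del: Int_insert_left Int_insert_right)
  qed
  then show ?thesis
    unfolding planar_def by blast
qed

section \<open>From vertex lists to cycles of arcs\<close>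

lemma pcas_zip: "pcas x (zip (x # xs) xs) (last (x # xs))"
  by (induction xs arbitrary: x) auto

lemma pawalk_verts_zip: "pawalk_verts x (zip (x # xs) xs) = x # xs"
  by (induction xs arbitrary: x) auto

lemma set_zip_successively:
  "set (zip (x # xs) xs) \<subseteq> R \<longleftrightarrow> successively (\<lambda>u v. (u, v) \<in> R) (x # xs)"
  by (induction xs arbitrary: x) auto

text \<open>Carries the condition on arc cycles over to vertex lists. Zipping the closed list
  \<open>x # ys @ [x]\<close> with its tail gives one arc for each vertex of the cycle.\<close>

lemma vertex_cycle_imp_undirected_cycle:
  assumes "pair_wf_digraph G" "vertex_cycle (\<lambda>u v. (u, v) \<in> parcs G) xs"
  shows "\<exists>p. undirected_cycle G p \<and> length p = length xs"
proof -
  interpret pair_wf_digraph G by fact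
  obtain x ys where xs: "xs = x # ys"
    using assms(2) by (cases xs) (auto simp: vertex_cycle_def)
  let ?p = "zip (x # ys @ [x]) (ys @ [x])"
  have "successively (\<lambda>u v. (u, v) \<in> parcs G) (x # ys @ [x])"
    using assms(2) successively_append_iff[of _ "x # ys" "[x]"] by (simp add: vertex_cycle_def xs)
  then have arcs: "set ?p \<subseteq> parcs G"
    by (simp only: set_zip_successively)
  moreover have "x \<in> pverts G"
    using arcs in_arcsD1 by (cases ys) auto
  moreover have "pcas x ?p x"
    using pcas_zip[of x "ys @ [x]"] by simp
  moreover have "distinct (tl (pawalk_verts x ?p))"
    unfolding pawalk_verts_zip using assms(2) by (simp add: vertex_cycle_def xs)
  ultimately have "pre_digraph.cycle (with_proj G) ?p"
    unfolding pre_digraph.cycle_def pre_digraph.awalk_def by (auto intro!: exI[of _ x])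
  moreover have "length ?p = length xs"
    by (simp add: xs)
  ultimately show ?thesis
    using assms(2) unfolding undirected_cycle_def vertex_cycle_def by auto
qed

lemma walk_weight_one: "walk_weight (\<lambda>_ _. 1) xs = length xs - 1"
  by (induction xs rule: induct_list012) auto

theorem mainTheorem15:
  fixes G :: "'a pair_pre_digraph"
  assumes "G \<in> eps12"
  shows "planar G"
proof -
  have "pair_graph G"
    and mod4: "\<And>p. undirected_cycle G p \<Longrightarrow> length p mod 4 = 1 \<or> length p mod 4 = 2"
    using assms by (auto simp: eps12_def Euler_graph_def)
  then interpret pair_graph G by blast
  \<comment> \<open>Any cycle yields an edge, hence the two vertices that the smallest 2-tree
    needs.\<close>
  obtain p where "undirected_cycle G p"
    using assms by (auto simp: eps12_def)
  then obtain e where "e \<in> parcs G"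
    by (cases p) (auto simp: undirected_cycle_def cycle_def awalk_def)
  then have "fst e \<in> pverts G" "snd e \<in> pverts G" "fst e \<noteq> snd e"
    using arc_fst_in_verts arc_snd_in_verts no_loops by auto
  then have card: "2 \<le> card (pverts G)"
    using card_mono[OF finite_verts, of "{fst e, snd e}"] by auto
  have "mod4_weighted_graph (pverts G) (\<lambda>u v. (u, v) \<in> parcs G) (\<lambda>_ _. 1)"
  proof
    show "finite (pverts G)" by simp
    show "x \<in> pverts G \<and> y \<in> pverts G \<and> x \<noteq> y" if "(x, y) \<in> parcs G" for x y
      using that arc_fst_in_verts arc_snd_in_verts no_loops by fastforce
    show "(y, x) \<in> parcs G" if "(x, y) \<in> parcs G" for x y
      using that arcs_symmetric by blast
    fix xs
    assume xs: "vertex_cycle (\<lambda>u v. (u, v) \<in> parcs G) xs"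
    \<comment> \<open>The walk has one edge fewer than vertices; the closing edge makes up for
      it.\<close>
    then have "cycle_weight (\<lambda>_ _. 1) xs = length xs"
      unfolding cycle_weight_def walk_weight_one vertex_cycle_def by linarith
    then show "cycle_weight (\<lambda>_ _. 1) xs mod 4 \<in> {1, 2}"
      using vertex_cycle_imp_undirected_cycle[OF pair_wf_digraph_axioms xs] mod4 by fastforce
  qed simp
  from mod4_weighted_graph_sub_two_tree[OF this card] obtain F where F: "two_tree (pverts G) F"
      "\<forall>u v. (u, v) \<in> parcs G \<longrightarrow> {u, v} \<in> F"
    by (elim exE conjE)
  obtain \<phi> :: "'a \<Rightarrow> real^2" where "straight_line_drawing (pverts G) F \<phi>"
    using two_tree_straight_line_drawing[OF F(1)] by blast
  then show ?thesis
    by (rule straight_line_drawing_imp_planar)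
      (use F arc_fst_in_verts arc_snd_in_verts no_loops in fastforce)
qed

end
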